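(* Fix integers $n\ge 4$ and $2\le k\le n-2$, let $x_1,\dots,x_n$ be distinct positive real numbers, and let $A_n=[1+x_ix_j]_{1\le i,j\le n}$. For $\epsilon\ge 0$ let $A_{n,k,\epsilon}=A_n+\epsilon R_{n,k}$, where $R_{n,k}$ is the $n\times n$ matrix with $1$ in the last $k$ diagonal entries and $0$ in all other entries. Then for all sufficiently small $\epsilon>0$ (i.e. there is $\epsilon_0>0$, depending on $A_n$, such that for every $\epsilon\in(0,\epsilon_0)$) the following hold: (i) there exists $\delta>0$ such that $[\ell-\delta,\ell+\delta]\subseteq S_{A_{n,k,\epsilon}}$ for every $\ell\in\{n-k-1,n-k,\dots,n-3\}$; (ii) for each $\ell\in\{n-k-1,n-k,\dots,n-3\}$ there exists $\alpha_\ell\in(\ell,\ell+1)$ such that $\alpha_\ell\notin S_{A_{n,k,\epsilon}}$; (iii) $S_{A_{n,k,\epsilon}}\cap[0,n-k-2]=\{0,1,\dots,n-k-2\}$.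
   Context: Let $\mathcal{P}_n^+$ denote the set of $n\times n$ (real symmetric) positive semi-definite matrices with non-negative entries. For $A=[a_{ij}]\in\mathcal{P}_n^+$ and real $\alpha\ge 0$, the $\alpha$th Hadamard (entrywise) power of $A$ is $A^{\circ\alpha}:=[a_{ij}^\alpha]$, with the convention $0^0=1$. For $A\in\mathcal{P}_n^+$ define $S_A:=\{\alpha\ge 0 : A^{\circ\alpha}\in\mathcal{P}_n^+\}$. The matrices $A_{n,k,\epsilon}$ belong to $\mathcal{P}_n^+$. *)

theory Defs
  imports Complex_Main "Jordan_Normal_Form.Matrix"
begin

text \<open>Matrices and vectors are indexed from 0, so index \<open>i < n\<close> stands for the
  index \<open>i + 1\<close> of the usual numbering \<open>1, \<dots>, n\<close>.\<close>

definition psd :: "nat \<Rightarrow> real mat \<Rightarrow> bool" where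
  "psd n A \<longleftrightarrow> A \<in> carrier_mat n n \<and> transpose_mat A = A \<and>
     (\<forall>v \<in> carrier_vec n. v \<bullet> (A *\<^sub>v v) \<ge> 0)"

definition psd_nonneg :: "nat \<Rightarrow> real mat set" where
  "psd_nonneg n = {A. psd n A \<and> (\<forall>i<n. \<forall>j<n. A $$ (i, j) \<ge> 0)}"

text \<open>The library has \<open>0 powr 0 = 0\<close>, whereas here \<open>0\<^sup>0 = 1\<close> is required.\<close>

definition rpow :: "real \<Rightarrow> real \<Rightarrow> real" where
  "rpow a \<alpha> = (if \<alpha> = 0 then 1 else a powr \<alpha>)"

definition hadamard_power :: "real mat \<Rightarrow> real \<Rightarrow> real mat" where
  "hadamard_power A \<alpha> = map_mat (\<lambda>a. rpow a \<alpha>) A"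

definition psd_powers :: "real mat \<Rightarrow> real set" where
  "psd_powers A = {\<alpha>. \<alpha> \<ge> 0 \<and> hadamard_power A \<alpha> \<in> psd_nonneg (dim_row A)}"

definition A_mat :: "nat \<Rightarrow> (nat \<Rightarrow> real) \<Rightarrow> real mat" where
  "A_mat n x = mat n n (\<lambda>(i, j). 1 + x i * x j)"

definition R_mat :: "nat \<Rightarrow> nat \<Rightarrow> real mat" where
  "R_mat n k = mat n n (\<lambda>(i, j). if i = j \<and> n - k \<le> i then 1 else 0)"

definition A_pert :: "nat \<Rightarrow> nat \<Rightarrow> (nat \<Rightarrow> real) \<Rightarrow> real \<Rightarrow> real mat" where
  "A_pert n k x \<epsilon> = A_mat n x + \<epsilon> \<cdot>\<^sub>m R_mat n k"

end

theory Submission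
  imports Defs
begin

text \<open>
  Everything rests on Jain's description of the powers of \<open>[1 + x\<^sub>i x\<^sub>j]\<close> itself. An integer power
  \<open>p\<close> is, by the binomial theorem, a positive combination of the rank one matrices
  \<open>[x\<^sub>i^q x\<^sub>j^q]\<close> with \<open>q \<le> p\<close>, so it is positive semidefinite. A power \<open>\<alpha>\<close> strictly between \<open>l\<close>
  and \<open>l + 1\<close> is not positive semidefinite once there are \<open>l + 3\<close> points
  (\<open>not_pos_semidef_fractional_power\<close>): the first negative coefficient of the binomial series of
  \<open>(1 + z) powr \<alpha>\<close> is that of \<open>z^(l + 2)\<close>, and a vector orthogonal to all lower powers of the
  points isolates it when the points are small. Arbitrary points are reached from small ones by
  scaling. On the way the matrix stays nonsingular, because Rolle's theorem bounds the number of
  zeros of a combination of the functions \<open>z \<mapsto> (1 + z x\<^sub>i) powr r\<close>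
  (\<open>affine_powers_independent\<close>), and positive semidefiniteness cannot be lost or gained along a
  continuous connected family of nonsingular symmetric matrices (\<open>pos_semidef_along_connected\<close>).

  The perturbation adds to the \<open>\<alpha>\<close>th power, \<open>\<alpha> > 0\<close>, a diagonal matrix that is positive on the last
  \<open>k\<close> indices and zero on the first \<open>m = n - k\<close>. At an integer \<open>l \<ge> m - 1\<close> a null vector of the
  perturbed power is therefore supported on the first \<open>m\<close> indices, where independence of the powers
  makes it vanish; the power is positive definite and stays so for nearby exponents, which is (i).
  For (ii), the unperturbed power \<open>l + 1/2\<close> takes a negative value on a fixed vector, and continuity
  in \<open>\<epsilon>\<close> preserves this; this is the only place where \<open>\<epsilon>\<close> has to be small. For (iii), the leading
  \<open>m \<times> m\<close> block is the unperturbed matrix of \<open>m\<close> points, which already excludes the nonintegers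
  below \<open>m - 2\<close>.
\<close>

section \<open>Quadratic forms\<close>

definition quad_form :: "'a set \<Rightarrow> ('a \<Rightarrow> 'a \<Rightarrow> real) \<Rightarrow> ('a \<Rightarrow> real) \<Rightarrow> real" where
  "quad_form I F v = (\<Sum>i\<in>I. \<Sum>j\<in>I. v i * v j * F i j)"

definition pos_semidef :: "'a set \<Rightarrow> ('a \<Rightarrow> 'a \<Rightarrow> real) \<Rightarrow> bool" where
  "pos_semidef I F \<longleftrightarrow> (\<forall>v. 0 \<le> quad_form I F v)"

definition pos_def :: "'a set \<Rightarrow> ('a \<Rightarrow> 'a \<Rightarrow> real) \<Rightarrow> bool" where
  "pos_def I F \<longleftrightarrow> (\<forall>v. (\<exists>i\<in>I. v i \<noteq> 0) \<longrightarrow> 0 < quad_form I F v)"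

lemma quad_form_cong:
  assumes "\<And>i j. i \<in> I \<Longrightarrow> j \<in> I \<Longrightarrow> F i j = G i j" "\<And>i. i \<in> I \<Longrightarrow> v i = w i"
  shows "quad_form I F v = quad_form I G w"
  unfolding quad_form_def using assms by (intro sum.cong) auto

lemma pos_semidef_cong:
  assumes "\<And>i j. i \<in> I \<Longrightarrow> j \<in> I \<Longrightarrow> F i j = G i j"
  shows "pos_semidef I F = pos_semidef I G"
proof -
  have "quad_form I F v = quad_form I G v" for v
    by (rule quad_form_cong) (use assms in auto)
  then show ?thesis by (simp add: pos_semidef_def)
qed

lemma quad_form_restrict:
  assumes "finite I" "J \<subseteq> I" "\<And>i. i \<in> I - J \<Longrightarrow> v i = 0"
  shows "quad_form I F v = quad_form J F v"
proof -
  have "(\<Sum>j\<in>I. v i * v j * F i j) = (\<Sum>j\<in>J. v i * v j * F i j)" for i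
    using assms by (intro sum.mono_neutral_right) auto
  then have "quad_form I F v = (\<Sum>i\<in>I. \<Sum>j\<in>J. v i * v j * F i j)"
    by (simp add: quad_form_def)
  also have "\<dots> = quad_form J F v"
    unfolding quad_form_def using assms by (intro sum.mono_neutral_right) auto
  finally show ?thesis .
qed

lemma pos_semidef_subset:
  assumes "finite I" "J \<subseteq> I" "pos_semidef I F"
  shows "pos_semidef J F"
  unfolding pos_semidef_def
proof
  fix v :: "'a \<Rightarrow> real"
  define w where "w = (\<lambda>i. if i \<in> J then v i else 0)"
  have "quad_form J F v = quad_form J F w"
    by (rule quad_form_cong) (auto simp: w_def)
  also have "\<dots> = quad_form I F w"
    by (rule quad_form_restrict[symmetric]) (use assms in \<open>auto simp: w_def\<close>)
  finally show "0 \<le> quad_form J F v"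
    using assms(3) by (simp add: pos_semidef_def)
qed

lemma quad_form_add_kernel:
  "quad_form I (\<lambda>i j. F i j + G i j) v = quad_form I F v + quad_form I G v"
  by (simp add: quad_form_def distrib_left sum.distrib)

lemma pos_def_imp_pos_semidef:
  assumes "pos_def I F"
  shows "pos_semidef I F"
  unfolding pos_semidef_def
proof
  fix v
  show "0 \<le> quad_form I F v"
  proof (cases "\<exists>i\<in>I. v i \<noteq> 0")
    case True
    then show ?thesis using assms by (auto simp: pos_def_def intro: less_imp_le)
  next
    case False
    then show ?thesis by (simp add: quad_form_def)
  qed
qed

lemma quad_form_rank_one:
  "quad_form I (\<lambda>i j. f i * f j) v = (\<Sum>i\<in>I. v i * f i)\<^sup>2"
  by (simp add: quad_form_def power2_eq_square sum_product mult_ac)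

text \<open>At a zero \<open>v\<close> of a nonnegative form the derivative in the direction of each unit vector has to
  vanish, since a nonzero linear term would dominate the quadratic one for small steps.\<close>

lemma quad_form_null_imp_kernel:
  assumes fin: "finite I" and sym: "\<And>i j. F i j = F j i"
    and psd: "pos_semidef I F" and null: "quad_form I F v = 0" and i: "i \<in> I"
  shows "(\<Sum>j\<in>I. v j * F i j) = 0"
proof (rule ccontr)
  define b where "b = (\<Sum>j\<in>I. v j * F i j)"
  assume "\<not> ?thesis"
  then have b: "b \<noteq> 0" by (simp add: b_def)
  have expand: "quad_form I F (\<lambda>j. v j + s * of_bool (j = i)) = 2 * s * b + s\<^sup>2 * F i i" for s
  proof -
    have "quad_form I F (\<lambda>j. v j + s * of_bool (j = i)) =
       (\<Sum>p\<in>I. \<Sum>j\<in>I. v p * v j * F p j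
          + (s * of_bool (p = i) * (v j * F p j)
          + (s * of_bool (j = i) * (v p * F p j) + s * s * (of_bool (p = i) * of_bool (j = i) * F p j))))"
      unfolding quad_form_def by (intro sum.cong refl) (simp add: algebra_simps)
    also have "\<dots> = quad_form I F v + (s * b + (s * b + s * s * F i i))"
    proof -
      have 1: "(\<Sum>p\<in>I. \<Sum>j\<in>I. s * of_bool (p = i) * (v j * F p j)) = s * b"
      proof -
        have "(\<Sum>p\<in>I. \<Sum>j\<in>I. s * of_bool (p = i) * (v j * F p j))
            = (\<Sum>p\<in>I. if p = i then s * (\<Sum>j\<in>I. v j * F p j) else 0)"
          by (intro sum.cong refl) (auto simp: sum_distrib_left)
        then show ?thesis using fin i by (simp add: b_def)
      qed
      have 2: "(\<Sum>p\<in>I. \<Sum>j\<in>I. s * of_bool (j = i) * (v p * F p j)) = s * b"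
        unfolding 1[symmetric] by (subst sum.swap) (intro sum.cong refl arg_cong2[where f = "(*)"] sym)
      have "(\<Sum>p\<in>I. \<Sum>j\<in>I. s * s * (of_bool (p = i) * of_bool (j = i) * F p j))
          = (\<Sum>p\<in>I. \<Sum>j\<in>I. if j = i then if p = i then s * s * F p j else 0 else 0)"
        by (intro sum.cong refl) auto
      also have "\<dots> = s * s * F i i"
        using fin i by simp
      finally show ?thesis
        by (simp only: sum.distrib 1 2 quad_form_def)
    qed
    finally show ?thesis by (simp add: null power2_eq_square)
  qed
  have nonneg: "0 \<le> 2 * s * b + s\<^sup>2 * F i i" for s
    using psd unfolding expand[symmetric] pos_semidef_def by blast
  \<comment> \<open>The step \<open>- b / c\<close> is short enough for the linear term to win, whatever the sign of \<open>F i i\<close>.\<close>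
  define c where "c = \<bar>F i i\<bar> + 1"
  have c: "c > 0" "F i i < c" by (auto simp: c_def)
  have "2 * (- b / c) * b + (- b / c)\<^sup>2 * F i i = (b / c)\<^sup>2 * (F i i - 2 * c)"
    using c by (simp add: field_simps power2_eq_square)
  moreover have "(b / c)\<^sup>2 * (F i i - 2 * c) < 0"
    using b c by (intro mult_pos_neg) auto
  ultimately show False using nonneg[of "- b / c"] by simp
qed

definition schur_compl :: "'a \<Rightarrow> ('a \<Rightarrow> 'a \<Rightarrow> real) \<Rightarrow> 'a \<Rightarrow> 'a \<Rightarrow> real" where
  "schur_compl q F i j = F i j - F q i * F q j / F q q"

text \<open>Completing the square in the coordinate \<open>v q\<close>.\<close>

lemma quad_form_insert_eq_schur:
  assumes "finite I" "q \<notin> I" and sym: "\<And>i j. F i j = F j i" and nz: "F q q \<noteq> 0"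
  shows "quad_form (insert q I) F v =
    F q q * (v q + (\<Sum>j\<in>I. v j * F q j) / F q q)\<^sup>2 + quad_form I (schur_compl q F) v"
proof -
  define b where "b = (\<Sum>j\<in>I. v j * F q j)"
  have "quad_form (insert q I) F v = v q * v q * F q q + v q * b + (v q * b + quad_form I F v)"
  proof -
    have "(\<Sum>j\<in>I. v q * v j * F q j) = v q * b"
      by (simp add: b_def sum_distrib_left mult.assoc)
    moreover have "(\<Sum>i\<in>I. v i * v q * F i q) = v q * b"
      unfolding b_def sum_distrib_left
      by (intro sum.cong refl) (simp add: sym[of _ q])
    ultimately show ?thesis
      using assms(1,2) by (simp add: quad_form_def sum.distrib)
  qed
  moreover have "quad_form I (schur_compl q F) v = quad_form I F v - b\<^sup>2 / F q q"
  proof -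
    have "quad_form I (schur_compl q F) v
        = (\<Sum>i\<in>I. \<Sum>j\<in>I. v i * v j * F i j - (v i * F q i) * (v j * F q j) / F q q)"
      unfolding quad_form_def schur_compl_def
      by (intro sum.cong refl) (simp add: right_diff_distrib mult_ac)
    also have "\<dots> = quad_form I F v - (\<Sum>i\<in>I. \<Sum>j\<in>I. (v i * F q i) * (v j * F q j)) / F q q"
      by (simp only: sum_subtractf quad_form_def sum_divide_distrib)
    finally show ?thesis by (simp only: b_def power2_eq_square sum_product)
  qed
  moreover have "F q q * (v q + b / F q q)\<^sup>2 = v q * v q * F q q + 2 * v q * b + b\<^sup>2 / F q q"
    using nz by (simp add: field_simps power2_eq_square)
  ultimately show ?thesis by (simp add: b_def)
qed

text \<open>This turns positive definiteness into a recursion on the index set whose data depend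
  continuously on the entries; it serves to prove openness without a compactness argument.\<close>

lemma pos_def_insert_iff_schur:
  assumes fin: "finite I" "q \<notin> I" and sym: "\<And>i j. F i j = F j i"
  shows "pos_def (insert q I) F \<longleftrightarrow> 0 < F q q \<and> pos_def I (schur_compl q F)"
proof safe
  assume pd: "pos_def (insert q I) F"
  have "quad_form (insert q I) F (\<lambda>i. of_bool (i = q)) = quad_form {q} F (\<lambda>i. of_bool (i = q))"
    by (rule quad_form_restrict) (use fin in auto)
  then have "quad_form (insert q I) F (\<lambda>i. of_bool (i = q)) = F q q"
    by (simp add: quad_form_def)
  moreover have "0 < quad_form (insert q I) F (\<lambda>i. of_bool (i = q))"
    using pd by (auto simp: pos_def_def)
  ultimately show Fq: "0 < F q q" by simp
  show "pos_def I (schur_compl q F)"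
    unfolding pos_def_def
  proof (intro allI impI)
    fix v :: "'a \<Rightarrow> real" assume v: "\<exists>i\<in>I. v i \<noteq> 0"
    \<comment> \<open>The choice of coordinate \<open>q\<close> that makes the completed square vanish.\<close>
    define w where "w = v(q := - (\<Sum>j\<in>I. v j * F q j) / F q q)"
    have w: "w i = v i" if "i \<in> I" for i using that fin by (auto simp: w_def)
    have "0 < quad_form (insert q I) F w"
      using pd v w by (auto simp: pos_def_def)
    also have "\<dots> = F q q * (w q + (\<Sum>j\<in>I. w j * F q j) / F q q)\<^sup>2 + quad_form I (schur_compl q F) w"
      by (rule quad_form_insert_eq_schur[OF fin sym]) (use Fq in auto)
    also have "(\<Sum>j\<in>I. w j * F q j) = (\<Sum>j\<in>I. v j * F q j)"
      using w by (intro sum.cong) auto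
    also have "w q + (\<Sum>j\<in>I. v j * F q j) / F q q = 0"
      by (simp add: w_def)
    also have "quad_form I (schur_compl q F) w = quad_form I (schur_compl q F) v"
      using w by (intro quad_form_cong) auto
    finally show "0 < quad_form I (schur_compl q F) v" by simp
  qed
next
  assume Fq: "0 < F q q" and pd: "pos_def I (schur_compl q F)"
  show "pos_def (insert q I) F"
    unfolding pos_def_def
  proof (intro allI impI)
    fix v :: "'a \<Rightarrow> real" assume v: "\<exists>i\<in>insert q I. v i \<noteq> 0"
    have eq: "quad_form (insert q I) F v =
      F q q * (v q + (\<Sum>j\<in>I. v j * F q j) / F q q)\<^sup>2 + quad_form I (schur_compl q F) v"
      by (rule quad_form_insert_eq_schur[OF fin sym]) (use Fq in auto)
    show "0 < quad_form (insert q I) F v"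
    proof (cases "\<exists>i\<in>I. v i \<noteq> 0")
      case True
      then have "0 < quad_form I (schur_compl q F) v" using pd by (auto simp: pos_def_def)
      then show ?thesis unfolding eq using Fq by (intro add_nonneg_pos) auto
    next
      case False
      then have "v q \<noteq> 0" "(\<Sum>j\<in>I. v j * F q j) = 0" "quad_form I (schur_compl q F) v = 0"
        using v by (auto simp: quad_form_def)
      then show ?thesis unfolding eq using Fq by simp
    qed
  qed
qed

text \<open>Positive definiteness is an open condition: each pivot of the elimination is a limit of
  pivots, and the Schur complement is continuous where the pivot is nonzero.\<close>

lemma eventually_pos_def:
  assumes "finite I" and "\<And>t i j. F t i j = F t j i" and "\<And>i j. G i j = G j i"
    and "\<And>i j. i \<in> I \<Longrightarrow> j \<in> I \<Longrightarrow> ((\<lambda>t. F t i j) \<longlongrightarrow> G i j) net"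
    and "pos_def I G"
  shows "eventually (\<lambda>t. pos_def I (F t)) net"
  using assms
proof (induction I arbitrary: F G rule: finite_induct)
  case empty
  then show ?case by (simp add: pos_def_def)
next
  case (insert q I)
  note symF = insert.prems(1) and symG = insert.prems(2) and lim = insert.prems(3)
  have Gq: "0 < G q q" and pdG: "pos_def I (schur_compl q G)"
    using pos_def_insert_iff_schur[of I q G, OF insert.hyps symG] insert.prems(4) by auto
  have "eventually (\<lambda>t. pos_def I (schur_compl q (F t))) net"
  proof (rule insert.IH[OF _ _ _ pdG])
    show "((\<lambda>t. schur_compl q (F t) i j) \<longlongrightarrow> schur_compl q G i j) net" if "i \<in> I" "j \<in> I" for i j
      unfolding schur_compl_def using that Gq by (intro tendsto_intros lim) auto
    show "schur_compl q (F t) i j = schur_compl q (F t) j i" for t i j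
      using symF[of t i j] by (simp add: schur_compl_def mult.commute)
    show "schur_compl q G i j = schur_compl q G j i" for i j
      using symG[of i j] by (simp add: schur_compl_def mult.commute)
  qed
  moreover have "eventually (\<lambda>t. 0 < F t q q) net"
    using lim[of q q] Gq by (intro order_tendstoD) auto
  ultimately show ?case
  proof eventually_elim
    case (elim t)
    then show ?case
      using pos_def_insert_iff_schur[of I q "F t", OF insert.hyps symF] by simp
  qed
qed

text \<open>A nonsingular positive semidefinite matrix is positive definite. In a continuous family of
  nonsingular matrices positive semidefiniteness is therefore an open condition, as is its negation.\<close>

lemma pos_semidef_along_connected:
  fixes F :: "'t::t2_space \<Rightarrow> 'a \<Rightarrow> 'a \<Rightarrow> real"
  assumes fin: "finite I" and conn: "connected S" and sym: "\<And>t i j. F t i j = F t j i"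
    and cont: "\<And>t i j. t \<in> S \<Longrightarrow> i \<in> I \<Longrightarrow> j \<in> I \<Longrightarrow> isCont (\<lambda>t. F t i j) t"
    and nonsing: "\<And>t v i. t \<in> S \<Longrightarrow> (\<And>p. p \<in> I \<Longrightarrow> (\<Sum>j\<in>I. v j * F t p j) = 0) \<Longrightarrow> i \<in> I \<Longrightarrow> v i = 0"
    and a: "a \<in> S" "pos_semidef I (F a)" and b: "b \<in> S"
  shows "pos_semidef I (F b)"
proof (rule ccontr)
  assume not_psd: "\<not> ?thesis"
  have lim: "((\<lambda>t. F t i j) \<longlongrightarrow> F t i j) (nhds t)" if "t \<in> S" "i \<in> I" "j \<in> I" for t i j
    using cont[OF that] unfolding continuous_at
    by (rule tendsto_at_iff_tendsto_nhds[of "\<lambda>t. F t i j" t, THEN iffD1])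
  have pd: "pos_def I (F t)" if t: "t \<in> S" "pos_semidef I (F t)" for t
    unfolding pos_def_def
  proof (intro allI impI)
    fix v :: "'a \<Rightarrow> real" assume v: "\<exists>i\<in>I. v i \<noteq> 0"
    have "quad_form I (F t) v \<noteq> 0"
    proof
      assume "quad_form I (F t) v = 0"
      then have "(\<Sum>j\<in>I. v j * F t p j) = 0" if "p \<in> I" for p
        using quad_form_null_imp_kernel[where F = "F t" and I = I] fin sym t(2) that by blast
      then show False using nonsing[OF t(1)] v by blast
    qed
    moreover have "0 \<le> quad_form I (F t) v" using t(2) by (simp add: pos_semidef_def)
    ultimately show "0 < quad_form I (F t) v" by simp
  qed
  \<comment> \<open>Two open sets that would disconnect \<open>S\<close>.\<close>
  define U where "U = \<Union>{T. open T \<and> (\<forall>t\<in>T. pos_def I (F t))}"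
  define V where "V = \<Union>{T. open T \<and> (\<forall>t\<in>T. \<not> pos_semidef I (F t))}"
  have U: "t \<in> U" if t: "t \<in> S" "pos_semidef I (F t)" for t
  proof -
    have "eventually (\<lambda>t. pos_def I (F t)) (nhds t)"
      using eventually_pos_def[where F = F and G = "F t" and net = "nhds t", OF fin sym sym lim[OF t(1)] pd[OF t]] .
    then show ?thesis by (auto simp: U_def eventually_nhds)
  qed
  have V: "t \<in> V" if t: "t \<in> S" "\<not> pos_semidef I (F t)" for t
  proof -
    obtain v where v: "quad_form I (F t) v < 0" using t(2) by (auto simp: pos_semidef_def not_le)
    have "((\<lambda>t. quad_form I (F t) v) \<longlongrightarrow> quad_form I (F t) v) (nhds t)"
      unfolding quad_form_def by (intro tendsto_intros lim[OF t(1)])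
    then have "eventually (\<lambda>t. quad_form I (F t) v < 0) (nhds t)"
      using v by (rule order_tendstoD)
    then have "eventually (\<lambda>t. \<not> pos_semidef I (F t)) (nhds t)"
      by eventually_elim (auto simp: pos_semidef_def not_le)
    then show ?thesis by (auto simp: V_def eventually_nhds)
  qed
  have "U \<inter> V = {}"
    using pos_def_imp_pos_semidef unfolding U_def V_def by blast
  then have "U \<inter> V \<inter> S = {}" by blast
  moreover have "open U" "open V" by (auto simp: U_def V_def)
  moreover have "S \<subseteq> U \<union> V" using U V by blast
  ultimately have "U \<inter> S = {} \<or> V \<inter> S = {}"
    using connectedD[OF conn] by blast
  then show False using U[OF a] V[OF b not_psd] a(1) b by blast
qed

section \<open>Linear independence of powers of linear functions\<close>

text \<open>Counting form of Rolle's theorem. The last conjunct keeps the zeros of the derivative strictly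
  below the largest zero of the function, so that adding a further zero on the right produces a
  new zero of the derivative.\<close>

lemma rolle_zeros:
  fixes g g' :: "real \<Rightarrow> real"
  assumes "finite Z" and "\<And>z. z \<in> Z \<Longrightarrow> a \<le> z \<and> g z = 0"
    and deriv: "\<And>t. a \<le> t \<Longrightarrow> (g has_real_derivative g' t) (at t)"
  shows "\<exists>W. finite W \<and> card Z \<le> Suc (card W) \<and> (\<forall>w\<in>W. a \<le> w \<and> g' w = 0 \<and> (\<exists>z\<in>Z. w < z))"
  using assms(1,2)
proof (induction Z rule: finite_linorder_max_induct)
  case empty
  then show ?case by (intro exI[of _ "{}"]) auto
next
  case (insert m Z)
  then obtain W where W: "finite W" "card Z \<le> Suc (card W)"
    "\<And>w. w \<in> W \<Longrightarrow> a \<le> w \<and> g' w = 0 \<and> (\<exists>z\<in>Z. w < z)"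
    by auto
  show ?case
  proof (cases "Z = {}")
    case True
    then show ?thesis by (intro exI[of _ "{}"]) auto
  next
    case False
    define M where "M = Max Z"
    have M: "M \<in> Z" "\<And>z. z \<in> Z \<Longrightarrow> z \<le> M"
      using insert.hyps(1) False by (auto simp: M_def)
    have Mm: "a \<le> M" "M < m" "g M = g m"
      using insert.hyps insert.prems M by auto
    obtain w where w: "M < w" "w < m" "(g has_real_derivative 0) (at w)"
    proof -
      have "\<exists>z>M. z < m \<and> (g has_real_derivative 0) (at z)"
      proof (rule Rolle[OF Mm(2,3)])
        show "continuous_on {M..m} g"
          using Mm deriv
          by (intro continuous_at_imp_continuous_on ballI DERIV_isCont[OF deriv]) auto
        show "\<And>x. M < x \<Longrightarrow> x < m \<Longrightarrow> g differentiable (at x)"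
          using Mm deriv by (meson less_imp_le order_trans real_differentiable_def)
      qed
      with that show thesis by blast
    qed
    have "g' w = 0"
      using DERIV_unique[OF deriv w(3)] w Mm by auto
    moreover have "w \<notin> W" using W(3) w(1) M(2) by fastforce
    moreover have "m \<notin> Z" using insert.hyps by auto
    ultimately show ?thesis
      using W w Mm insert.hyps(1) by (intro exI[of _ "insert w W"]) fastforce
  qed
qed

text \<open>A nontrivial combination of \<open>N\<close> functions \<open>z \<mapsto> (1 + z x\<^sub>i) powr r\<close> has fewer than \<open>N\<close> zeros on
  the nonnegative axis. Dividing by one of the functions turns it into a constant, and
  differentiating removes it: the derivative is, up to a positive factor and \<open>r\<close>, a combination of
  the remaining functions with exponent \<open>r - 1\<close>. The exponents \<open>0, \<dots>, N - 2\<close> are excluded because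
  the factor \<open>r\<close> must stay nonzero through all \<open>N - 1\<close> steps; at these exponents the functions are
  polynomials of degree at most \<open>N - 2\<close> and indeed dependent.\<close>

lemma affine_powers_independent:
  fixes x c :: "'a \<Rightarrow> real"
  assumes "finite I" and "inj_on x I" and "\<And>i. i \<in> I \<Longrightarrow> 0 \<le> x i"
    and "finite Z" and "card I \<le> card Z" and "\<And>z. z \<in> Z \<Longrightarrow> 0 \<le> z"
    and "\<And>m. Suc m < card I \<Longrightarrow> r \<noteq> real m"
    and "\<And>z. z \<in> Z \<Longrightarrow> (\<Sum>i\<in>I. c i * (1 + z * x i) powr r) = 0"
    and "i \<in> I"
  shows "c i = 0"
  using assms
proof (induction I arbitrary: r c Z i rule: finite_induct)
  case empty
  then show ?case by simp
next
  case (insert q I)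
  have pos: "0 < 1 + z * x p" if "0 \<le> z" "p \<in> insert q I" for z p
    using that insert.prems(2) by (simp add: add_pos_nonneg)
  have card: "card (insert q I) = Suc (card I)" using insert.hyps by simp
  have cI: "c p = 0" if p: "p \<in> I" for p
  proof -
    have "card I \<noteq> 0" using p insert.hyps by auto
    then have r: "r \<noteq> 0" using insert.prems(6)[of 0] card by auto
    define g where "g z = c q + (\<Sum>j\<in>I. c j * ((1 + z * x j) / (1 + z * x q)) powr r)" for z
    define s where "s z = (\<Sum>j\<in>I. (c j * (x j - x q)) * (1 + z * x j) powr (r - 1))" for z
    define g' where "g' z = r * s z / (1 + z * x q) powr (r + 1)" for z
    have g_eq: "g z = (\<Sum>j\<in>insert q I. c j * (1 + z * x j) powr r) / (1 + z * x q) powr r"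
      if "0 \<le> z" for z
    proof -
      have "(\<Sum>j\<in>I. c j * ((1 + z * x j) / (1 + z * x q)) powr r)
          = (\<Sum>j\<in>I. c j * (1 + z * x j) powr r) / (1 + z * x q) powr r"
        unfolding sum_divide_distrib using pos[OF that]
        by (intro sum.cong refl) (simp add: powr_divide less_imp_le)
      then show ?thesis
        using insert.hyps pos[OF that, of q] by (simp add: g_def add_divide_distrib)
    qed
    have deriv: "(g has_real_derivative g' z) (at z)" if z: "0 \<le> z" for z
    proof -
      have "((\<lambda>z. c j * ((1 + z * x j) / (1 + z * x q)) powr r) has_real_derivative
          r * ((c j * (x j - x q)) * (1 + z * x j) powr (r - 1)) / (1 + z * x q) powr (r + 1)) (at z)"
        if j: "j \<in> I" for j
      proof -
        define A where "A = 1 + z * x j"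
        define B where "B = 1 + z * x q"
        have AB: "0 < A" "0 < B" using pos[OF z] j by (auto simp: A_def B_def)
        have num: "x j * B - A * x q = x j - x q" by (simp add: A_def B_def algebra_simps)
        have "((\<lambda>z. (1 + z * x j) / (1 + z * x q)) has_real_derivative (x j - x q) / (B * B)) (at z)"
          using AB num unfolding A_def B_def by (auto intro!: derivative_eq_intros)
        from DERIV_fun_powr[OF this, of r] AB
        have "((\<lambda>z. ((1 + z * x j) / (1 + z * x q)) powr r) has_real_derivative
            r * (A / B) powr (r - 1) * ((x j - x q) / (B * B))) (at z)"
          by (simp add: A_def B_def)
        then have deriv_j: "((\<lambda>z. c j * ((1 + z * x j) / (1 + z * x q)) powr r) has_real_derivative
            c j * (r * (A / B) powr (r - 1) * ((x j - x q) / (B * B)))) (at z)"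
          by (rule DERIV_cmult)
        have "(A / B) powr (r - 1) / (B * B) = A powr (r - 1) / B powr (r + 1)"
        proof -
          have "B powr (r + 1) = B powr (r - 1) * (B * B)"
            using AB powr_add[of B "r - 1" 2] by (simp add: power2_eq_square add.commute)
          then show ?thesis using AB by (simp add: powr_divide)
        qed
        moreover have "c j * (r * (A / B) powr (r - 1) * ((x j - x q) / (B * B)))
            = r * (c j * (x j - x q)) * ((A / B) powr (r - 1) / (B * B))"
          by simp
        ultimately have "c j * (r * (A / B) powr (r - 1) * ((x j - x q) / (B * B)))
            = r * ((c j * (x j - x q)) * A powr (r - 1)) / B powr (r + 1)"
          by simp
        with deriv_j show ?thesis by (simp add: A_def B_def)
      qed
      then have "((\<lambda>z. \<Sum>j\<in>I. c j * ((1 + z * x j) / (1 + z * x q)) powr r) has_real_derivative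
          (\<Sum>j\<in>I. r * ((c j * (x j - x q)) * (1 + z * x j) powr (r - 1)) / (1 + z * x q) powr (r + 1))) (at z)"
        by (rule DERIV_sum)
      from DERIV_add[OF DERIV_const[of "c q"] this] show ?thesis
        unfolding g_def[abs_def] g'_def s_def sum_distrib_left sum_divide_distrib
        by (simp only: add_0_left)
    qed
    obtain W where W: "finite W" "card Z \<le> Suc (card W)" "\<And>w. w \<in> W \<Longrightarrow> 0 \<le> w \<and> g' w = 0"
      using rolle_zeros[of Z 0 g g'] insert.prems(3,5,7) g_eq deriv by fastforce
    have "c p * (x p - x q) = 0"
    proof (rule insert.IH[of W "r - 1" "\<lambda>j. c j * (x j - x q)"])
      show "card I \<le> card W" using W(2) insert.prems(4) card by simp
      show "r - 1 \<noteq> real m" if "Suc m < card I" for m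
        using insert.prems(6)[of "Suc m"] that card by auto
      show "(\<Sum>i\<in>I. c i * (x i - x q) * (1 + w * x i) powr (r - 1)) = 0" if "w \<in> W" for w
        using W(3)[OF that] pos[of w q] r by (simp add: g'_def s_def)
    qed (use insert.prems W p in auto)
    moreover have "x p \<noteq> x q"
      using insert.prems(1) insert.hyps p by (auto simp: inj_on_def)
    ultimately show ?thesis by simp
  qed
  obtain z where z: "z \<in> Z" using insert.prems(4) card by fastforce
  have "(\<Sum>i\<in>insert q I. c i * (1 + z * x i) powr r) = c q * (1 + z * x q) powr r"
    using insert.hyps cI by simp
  then have "c q = 0"
    using insert.prems(7)[OF z] pos[of z q] insert.prems(5)[OF z] by simp
  then show ?case using cI insert.prems(8) by auto
qed

section \<open>Powers of the matrix with entries one plus a product\<close>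

text \<open>These weights are the coefficients of the divided difference of order \<open>card I - 1\<close>, which kills
  lower powers. The inductive step is the recursion that makes multiplication by \<open>x - x\<^sub>q\<close> lower the
  order by one.\<close>

lemma divided_difference_weights:
  fixes x :: "'a \<Rightarrow> real"
  assumes "finite I" and "inj_on x I" and "I \<noteq> {}"
  shows "\<exists>v. (\<forall>p. Suc p < card I \<longrightarrow> (\<Sum>i\<in>I. v i * x i ^ p) = 0) \<and>
             (\<Sum>i\<in>I. v i * x i ^ (card I - 1)) = 1"
  using assms(1,3,2)
proof (induction I rule: finite_ne_induct)
  case (singleton q)
  show ?case by (intro exI[of _ "\<lambda>_. 1"]) simp
next
  case (insert q I)
  then obtain v where v: "\<And>p. Suc p < card I \<Longrightarrow> (\<Sum>i\<in>I. v i * x i ^ p) = 0"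
    "(\<Sum>i\<in>I. v i * x i ^ (card I - 1)) = 1"
    by auto
  have card: "card (insert q I) = Suc (card I)" "card I > 0"
    using insert.hyps by (auto simp: card_gt_0_iff)
  have ne: "x i \<noteq> x q" if "i \<in> I" for i
    using insert.prems insert.hyps that by (auto simp: inj_on_def)
  \<comment> \<open>The weight at \<open>q\<close> is forced by the moment of order zero.\<close>
  define u where "u i = v i / (x i - x q)" for i
  define w where "w i = (if i = q then - sum u I else u i)" for i
  define m where "m p = (\<Sum>i\<in>insert q I. w i * x i ^ p)" for p
  have m_eq: "m p = (\<Sum>i\<in>I. u i * x i ^ p) - sum u I * x q ^ p" for p
  proof -
    have "(\<Sum>i\<in>I. w i * x i ^ p) = (\<Sum>i\<in>I. u i * x i ^ p)"
      using insert.hyps by (intro sum.cong) (auto simp: w_def)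
    then show ?thesis using insert.hyps by (simp add: m_def w_def)
  qed
  have m0: "m 0 = 0" by (simp add: m_eq)
  have step: "m (Suc p) = x q * m p + (\<Sum>i\<in>I. v i * x i ^ p)" for p
  proof -
    have "m (Suc p) - x q * m p = (\<Sum>i\<in>I. u i * x i ^ Suc p) - x q * (\<Sum>i\<in>I. u i * x i ^ p)"
      by (simp add: m_eq algebra_simps)
    also have "\<dots> = (\<Sum>i\<in>I. u i * (x i - x q) * x i ^ p)"
      by (simp add: sum_distrib_left sum_subtractf[symmetric] algebra_simps)
    also have "\<dots> = (\<Sum>i\<in>I. v i * x i ^ p)"
      using ne by (intro sum.cong) (auto simp: u_def)
    finally show ?thesis by simp
  qed
  have zero: "m p = 0" if "p < card I" for p
    using that by (induction p) (auto simp: m0 step v)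
  have "m (card I) = 1"
    using step[of "card I - 1"] zero[of "card I - 1"] v(2) card by simp
  with zero show ?case unfolding card(1) by (intro exI[of _ w]) (auto simp: m_def)
qed

text \<open>On the divided difference weights the form, as a function of \<open>s\<close>, has vanishing derivatives at
  \<open>0\<close> below order \<open>l + 2\<close>, and its derivative of that order is
  \<open>\<alpha> (\<alpha> - 1) \<dots> (\<alpha> - l - 1)\<close>, whose last factor alone is negative.\<close>

lemma not_pos_semidef_fractional_power_near_origin:
  fixes x :: "'a \<Rightarrow> real"
  assumes fin: "finite I" and inj: "inj_on x I" and pos: "\<And>i. i \<in> I \<Longrightarrow> 0 < x i"
    and card: "card I = l + 3" and \<alpha>: "real l < \<alpha>" "\<alpha> < real l + 1"
  shows "\<exists>s. 0 < s \<and> s \<le> 1 \<and> \<not> pos_semidef I (\<lambda>i j. (1 + s * (x i * x j)) powr \<alpha>)"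
proof -
  have "I \<noteq> {}" using card by auto
  from divided_difference_weights[OF fin inj this] obtain v where
    v: "\<And>p. p < l + 2 \<Longrightarrow> (\<Sum>i\<in>I. v i * x i ^ p) = 0" "(\<Sum>i\<in>I. v i * x i ^ (l + 2)) = 1"
    by (auto simp: card)
  \<comment> \<open>The falling factorials of \<open>\<alpha>\<close>, and the derivatives of the form with respect to \<open>s\<close>.\<close>
  define ff where "ff p = (\<Prod>m<p. \<alpha> - real m)" for p :: nat
  define d where "d p s = quad_form I (\<lambda>i j. ff p * ((x i * x j) ^ p * (1 + s * (x i * x j)) powr (\<alpha> - real p))) v"
    for p s
  have base: "0 < 1 + s * (x i * x j)" if "i \<in> I" "j \<in> I" "0 \<le> s" for i j s
    using that pos[of i] pos[of j] by (simp add: add_pos_nonneg)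
  have d0: "d p 0 = ff p * (\<Sum>i\<in>I. v i * x i ^ p)\<^sup>2" for p
    unfolding quad_form_rank_one[symmetric] d_def
    by (simp add: quad_form_def sum_distrib_left power_mult_distrib mult_ac)
  have deriv: "(d p has_real_derivative d (Suc p) s) (at s)" if s: "0 \<le> s" for p s
  proof -
    have "((\<lambda>s. v i * v j * (ff p * ((x i * x j) ^ p * (1 + s * (x i * x j)) powr (\<alpha> - real p))))
        has_real_derivative v i * v j * (ff (Suc p) *
          ((x i * x j) ^ Suc p * (1 + s * (x i * x j)) powr (\<alpha> - real (Suc p))))) (at s)"
      if ij: "i \<in> I" "j \<in> I" for i j
    proof -
      define y where "y = x i * x j"
      have "((\<lambda>s. 1 + s * y) has_real_derivative y) (at s)"
        by (auto intro!: derivative_eq_intros)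
      from DERIV_fun_powr[OF this, of "\<alpha> - real p"] base[OF ij s]
      have "((\<lambda>s. (1 + s * y) powr (\<alpha> - real p)) has_real_derivative
          (\<alpha> - real p) * (1 + s * y) powr (\<alpha> - real p - 1) * y) (at s)"
        by (simp add: y_def)
      then have "((\<lambda>s. (v i * v j * ff p * y ^ p) * (1 + s * y) powr (\<alpha> - real p)) has_real_derivative
          (v i * v j * ff p * y ^ p) * ((\<alpha> - real p) * (1 + s * y) powr (\<alpha> - real p - 1) * y)) (at s)"
        by (rule DERIV_cmult)
      moreover have "\<alpha> - real (Suc p) = \<alpha> - real p - 1" by simp
      ultimately show ?thesis
        unfolding y_def[symmetric] by (simp only: ff_def prod.lessThan_Suc power_Suc mult_ac)
    qed
    then show ?thesis
      unfolding d_def[abs_def] quad_form_def by (intro DERIV_sum) auto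
  qed
  have "ff (l + 2) = (\<Prod>m<l + 1. \<alpha> - real m) * (\<alpha> - real (l + 1))"
    by (simp add: ff_def)
  moreover have "(\<Prod>m<l + 1. \<alpha> - real m) > 0"
    using \<alpha> by (intro prod_pos) auto
  ultimately have "ff (l + 2) < 0"
    using \<alpha> by (simp add: mult_pos_neg)
  then have "d (l + 2) 0 < 0" unfolding d0 v(2) by simp
  moreover have "(d (l + 2) \<longlongrightarrow> d (l + 2) 0) (at_right 0)"
    using DERIV_isCont[OF deriv[of 0 "l + 2"]] by (simp add: continuous_at filterlim_at_split)
  ultimately have "eventually (\<lambda>s. d (l + 2) s < 0) (at_right 0)"
    by (metis order_tendstoD(2))
  then obtain h0 where h0: "0 < h0" "\<And>s. 0 < s \<Longrightarrow> s < h0 \<Longrightarrow> d (l + 2) s < 0"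
    by (auto simp: eventually_at_right_field)
  define h where "h = min 1 h0"
  have h: "0 < h" "h \<le> 1" "h \<le> h0" using h0 by (auto simp: h_def)
  obtain t where t: "0 < t" "t < h"
    "d 0 h = (\<Sum>m<l + 2. d m 0 / fact m * h ^ m) + d (l + 2) t / fact (l + 2) * h ^ (l + 2)"
    using Maclaurin[of h "l + 2" d "d 0"] h deriv by auto
  have "(\<Sum>m<l + 2. d m 0 / fact m * h ^ m) = 0"
    by (intro sum.neutral ballI) (simp only: d0 v lessThan_iff, simp)
  moreover have "d (l + 2) t / fact (l + 2) * h ^ (l + 2) < 0"
    using h0(2)[OF t(1)] t h by (intro mult_neg_pos divide_neg_pos) auto
  ultimately have "d 0 h < 0" using t(3) by simp
  moreover have "d 0 h = quad_form I (\<lambda>i j. (1 + h * (x i * x j)) powr \<alpha>) v"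
    by (simp add: d_def ff_def)
  ultimately show ?thesis using h by (intro exI[of _ h]) (auto simp: pos_semidef_def not_le)
qed

text \<open>Scaling all products \<open>x\<^sub>i x\<^sub>j\<close> by \<open>t > 0\<close> keeps the matrix nonsingular: a null vector gives a
  combination of the powers of \<open>1 + z x\<^sub>j\<close> that vanishes at the \<open>card I\<close> points \<open>z = t x\<^sub>i\<close>. So the
  failure near the origin spreads to \<open>t = 1\<close>.\<close>

lemma not_pos_semidef_fractional_power:
  fixes x :: "'a \<Rightarrow> real"
  assumes fin: "finite I" and inj: "inj_on x I" and pos: "\<And>i. i \<in> I \<Longrightarrow> 0 < x i"
    and card: "card I = l + 3" and \<alpha>: "real l < \<alpha>" "\<alpha> < real l + 1"
  shows "\<not> pos_semidef I (\<lambda>i j. (1 + x i * x j) powr \<alpha>)"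
proof
  assume psd1: "pos_semidef I (\<lambda>i j. (1 + x i * x j) powr \<alpha>)"
  obtain s where s: "0 < s" "s \<le> 1" "\<not> pos_semidef I (\<lambda>i j. (1 + s * (x i * x j)) powr \<alpha>)"
    using not_pos_semidef_fractional_power_near_origin[OF assms] by blast
  have "pos_semidef I (\<lambda>i j. (1 + s * (x i * x j)) powr \<alpha>)"
  proof (rule pos_semidef_along_connected[where S = "{0<..}" and a = 1
        and F = "\<lambda>t i j. (1 + t * (x i * x j)) powr \<alpha>"])
    show "isCont (\<lambda>t. (1 + t * (x i * x j)) powr \<alpha>) t"
      if "t \<in> {0<..}" "i \<in> I" "j \<in> I" for t i j
    proof -
      have "0 < 1 + t * (x i * x j)" using that pos[of i] pos[of j] by (simp add: add_pos_pos)
      then show ?thesis by (intro continuous_intros) auto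
    qed
    show "v i = 0" if t: "t \<in> {0<..}"
      and zero: "\<And>p. p \<in> I \<Longrightarrow> (\<Sum>j\<in>I. v j * (1 + t * (x p * x j)) powr \<alpha>) = 0" and i: "i \<in> I"
    for t v i
    proof (rule affine_powers_independent[where Z = "(\<lambda>p. t * x p) ` I" and r = \<alpha>, OF fin inj])
      have "inj_on (\<lambda>p. t * x p) I" using inj t by (auto simp: inj_on_def)
      then show "card I \<le> card ((\<lambda>p. t * x p) ` I)" by (simp add: card_image)
      show "\<alpha> \<noteq> real m" for m
      proof
        assume "\<alpha> = real m"
        with \<alpha> have "l < m" "m < l + 1" by linarith+
        then show False by simp
      qed
      show "(\<Sum>i\<in>I. v i * (1 + z * x i) powr \<alpha>) = 0" if "z \<in> (\<lambda>p. t * x p) ` I" for z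
        using that zero by (auto simp: mult.assoc)
    qed (use fin pos t i in \<open>auto intro: less_imp_le\<close>)
  qed (use fin psd1 s in \<open>auto simp: mult.commute\<close>)
  with s show False by simp
qed

lemma pos_semidef_nat_power:
  "pos_semidef I (\<lambda>i j. (1 + x i * x j) ^ m)"
proof -
  have "quad_form I (\<lambda>i j. (1 + x i * x j) ^ m) v
      = (\<Sum>p\<le>m. real (m choose p) * quad_form I (\<lambda>i j. x i ^ p * x j ^ p) v)" for v
  proof -
    have "(1 + x i * x j) ^ m = (\<Sum>p\<le>m. real (m choose p) * (x i ^ p * x j ^ p))" for i j
      using binomial_ring[of "x i * x j" 1 m] by (simp add: power_mult_distrib add.commute)
    then have "quad_form I (\<lambda>i j. (1 + x i * x j) ^ m) v
      = (\<Sum>i\<in>I. \<Sum>j\<in>I. \<Sum>p\<le>m. real (m choose p) * (v i * v j * (x i ^ p * x j ^ p)))"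
      by (simp add: quad_form_def sum_distrib_left mult_ac)
    also have "\<dots> = (\<Sum>i\<in>I. \<Sum>p\<le>m. \<Sum>j\<in>I. real (m choose p) * (v i * v j * (x i ^ p * x j ^ p)))"
      by (intro sum.cong refl sum.swap)
    also have "\<dots> = (\<Sum>p\<le>m. \<Sum>i\<in>I. \<Sum>j\<in>I. real (m choose p) * (v i * v j * (x i ^ p * x j ^ p)))"
      by (rule sum.swap)
    finally show ?thesis by (simp add: quad_form_def sum_distrib_left)
  qed
  then show ?thesis
    unfolding pos_semidef_def quad_form_rank_one by (auto intro!: sum_nonneg)
qed

section \<open>The perturbed matrix\<close>

definition pert_entry :: "nat \<Rightarrow> (nat \<Rightarrow> real) \<Rightarrow> real \<Rightarrow> nat \<Rightarrow> nat \<Rightarrow> real" where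
  "pert_entry m x \<epsilon> i j = 1 + x i * x j + \<epsilon> * of_bool (i = j \<and> m \<le> i)"

lemma pert_entry_commute: "pert_entry m x \<epsilon> i j = pert_entry m x \<epsilon> j i"
  by (auto simp: pert_entry_def)

lemma psd_iff_pos_semidef:
  assumes "\<And>i j. F i j = F j i"
  shows "psd n (mat n n (\<lambda>(i, j). F i j)) \<longleftrightarrow> pos_semidef {..<n} F"
proof -
  have form: "v \<bullet> (mat n n (\<lambda>(i, j). F i j) *\<^sub>v v) = quad_form {..<n} F (\<lambda>i. v $ i)"
    if "v \<in> carrier_vec n" for v
    using that by (simp add: scalar_prod_def quad_form_def sum_distrib_left mult_ac lessThan_atLeast0)
  have "transpose_mat (mat n n (\<lambda>(i, j). F i j)) = mat n n (\<lambda>(i, j). F i j)"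
    using assms by (intro eq_matI) auto
  then have "psd n (mat n n (\<lambda>(i, j). F i j)) \<longleftrightarrow>
      (\<forall>v \<in> carrier_vec n. 0 \<le> quad_form {..<n} F (\<lambda>i. v $ i))"
    using form by (simp add: psd_def)
  also have "\<dots> \<longleftrightarrow> pos_semidef {..<n} F"
  proof
    assume vecs: "\<forall>v \<in> carrier_vec n. 0 \<le> quad_form {..<n} F (\<lambda>i. v $ i)"
    show "pos_semidef {..<n} F"
      unfolding pos_semidef_def
    proof
      fix v
      have "quad_form {..<n} F v = quad_form {..<n} F (\<lambda>i. vec n v $ i)"
        by (rule quad_form_cong) auto
      then show "0 \<le> quad_form {..<n} F v" using vecs by simp
    qed
  qed (simp add: pos_semidef_def)
  finally show ?thesis .
qed

text \<open>All entries are positive, so the convention for \<open>0\<^sup>0\<close> and the sign condition on the entries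
  disappear.\<close>

lemma mem_psd_powers_iff:
  assumes pos: "\<And>i. i < n \<Longrightarrow> x i > 0" and \<epsilon>: "0 \<le> \<epsilon>"
  shows "\<alpha> \<in> psd_powers (A_pert n k x \<epsilon>) \<longleftrightarrow>
    0 \<le> \<alpha> \<and> pos_semidef {..<n} (\<lambda>i j. pert_entry (n - k) x \<epsilon> i j powr \<alpha>)"
proof -
  have entry: "0 < pert_entry (n - k) x \<epsilon> i j" if "i < n" "j < n" for i j
    using that pos[of i] pos[of j] \<epsilon> by (auto simp: pert_entry_def add_pos_nonneg)
  have "hadamard_power (A_pert n k x \<epsilon>) \<alpha> = mat n n (\<lambda>(i, j). pert_entry (n - k) x \<epsilon> i j powr \<alpha>)"
  proof (rule eq_matI)
    fix i j
    assume "i < dim_row (mat n n (\<lambda>(i, j). pert_entry (n - k) x \<epsilon> i j powr \<alpha>))"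
      "j < dim_col (mat n n (\<lambda>(i, j). pert_entry (n - k) x \<epsilon> i j powr \<alpha>))"
    then have ij: "i < n" "j < n" by auto
    then have "A_pert n k x \<epsilon> $$ (i, j) = pert_entry (n - k) x \<epsilon> i j"
      by (auto simp: A_pert_def A_mat_def R_mat_def pert_entry_def)
    then show "hadamard_power (A_pert n k x \<epsilon>) \<alpha> $$ (i, j)
      = mat n n (\<lambda>(i, j). pert_entry (n - k) x \<epsilon> i j powr \<alpha>) $$ (i, j)"
      using ij entry[OF ij]
      by (auto simp: hadamard_power_def rpow_def A_pert_def A_mat_def R_mat_def)
  qed (auto simp: hadamard_power_def A_pert_def A_mat_def R_mat_def)
  moreover have "dim_row (A_pert n k x \<epsilon>) = n"
    by (simp add: A_pert_def A_mat_def R_mat_def)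
  moreover have "psd n (mat n n (\<lambda>(i, j). pert_entry (n - k) x \<epsilon> i j powr \<alpha>)) \<longleftrightarrow>
      pos_semidef {..<n} (\<lambda>i j. pert_entry (n - k) x \<epsilon> i j powr \<alpha>)"
    by (rule psd_iff_pos_semidef) (simp add: pert_entry_commute)
  ultimately show ?thesis by (auto simp: psd_powers_def psd_nonneg_def)
qed

lemma quad_form_pert_powr:
  assumes "\<And>i. i < n \<Longrightarrow> x i > 0" and "0 \<le> \<epsilon>"
  shows "quad_form {..<n} (\<lambda>i j. pert_entry m x \<epsilon> i j powr \<alpha>) v =
    quad_form {..<n} (\<lambda>i j. (1 + x i * x j) powr \<alpha>) v +
    (\<Sum>i\<in>{m..<n}. (v i)\<^sup>2 * ((1 + x i * x i + \<epsilon>) powr \<alpha> - (1 + x i * x i) powr \<alpha>))"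
proof -
  define D where "D i = (1 + x i * x i + \<epsilon>) powr \<alpha> - (1 + x i * x i) powr \<alpha>" for i
  have "quad_form {..<n} (\<lambda>i j. pert_entry m x \<epsilon> i j powr \<alpha>) v =
      quad_form {..<n} (\<lambda>i j. (1 + x i * x j) powr \<alpha> + (if j = i then if m \<le> i then D i else 0 else 0)) v"
    by (rule quad_form_cong) (auto simp: pert_entry_def D_def)
  also have "\<dots> = quad_form {..<n} (\<lambda>i j. (1 + x i * x j) powr \<alpha>) v
      + quad_form {..<n} (\<lambda>i j. if j = i then if m \<le> i then D i else 0 else 0) v"
    by (rule quad_form_add_kernel)
  also have "quad_form {..<n} (\<lambda>i j. if j = i then if m \<le> i then D i else 0 else 0) v
      = (\<Sum>i<n. if m \<le> i then (v i)\<^sup>2 * D i else 0)"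
  proof -
    have "(\<Sum>j<n. v i * v j * (if j = i then if m \<le> i then D i else 0 else 0))
        = (if m \<le> i then (v i)\<^sup>2 * D i else 0)" if "i < n" for i
    proof -
      have "(\<Sum>j<n. v i * v j * (if j = i then if m \<le> i then D i else 0 else 0))
        = (\<Sum>j<n. if j = i then v i * v j * (if m \<le> i then D i else 0) else 0)"
        by (intro sum.cong) auto
      then show ?thesis using that by (simp add: power2_eq_square)
    qed
    then show ?thesis unfolding quad_form_def by (intro sum.cong) auto
  qed
  also have "\<dots> = (\<Sum>i\<in>{i\<in>{..<n}. m \<le> i}. (v i)\<^sup>2 * D i)"
    by (subst sum.inter_filter) auto
  also have "{i\<in>{..<n}. m \<le> i} = {m..<n}" by auto
  finally show ?thesis by (simp add: D_def)
qed

lemma pert_gain_pos: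
  assumes "(x::real) > 0" "0 < \<epsilon>" "0 < \<alpha>"
  shows "0 < (1 + x * x + \<epsilon>) powr \<alpha> - (1 + x * x) powr \<alpha>"
  using assms powr_less_mono2[of \<alpha> "1 + x * x" "1 + x * x + \<epsilon>"] by (simp add: add_pos_pos)

lemma pos_semidef_powr_nat:
  assumes "\<And>i. i < n \<Longrightarrow> x i > 0"
  shows "pos_semidef {..<n} (\<lambda>i j. (1 + x i * x j) powr real p)"
proof -
  have "(1 + x i * x j) powr real p = (1 + x i * x j) ^ p" if "i < n" "j < n" for i j
    using that assms by (intro powr_realpow) (simp add: add_pos_pos)
  then show ?thesis
    using pos_semidef_nat_power[of "{..<n}" x p] by (subst pos_semidef_cong) auto
qed

lemma pos_semidef_pert_nat:
  assumes pos: "\<And>i. i < n \<Longrightarrow> x i > 0" and \<epsilon>: "0 < \<epsilon>"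
  shows "pos_semidef {..<n} (\<lambda>i j. pert_entry m x \<epsilon> i j powr real p)"
proof (cases "p = 0")
  case True
  have "pert_entry m x \<epsilon> i j powr 0 = (1 + x i * x j) powr real 0" if "i < n" "j < n" for i j
    using that pos[of i] pos[of j] \<epsilon> add_pos_pos[of 1 "x i * x j"]
      add_pos_pos[of "1 + x i * x j" \<epsilon>] by (auto simp: pert_entry_def)
  then show ?thesis
    using pos_semidef_powr_nat[of n x 0] pos True by (subst pos_semidef_cong) auto
next
  case False
  show ?thesis
    unfolding pos_semidef_def
  proof
    fix v
    have "0 \<le> (\<Sum>i\<in>{m..<n}. (v i)\<^sup>2 * ((1 + x i * x i + \<epsilon>) powr real p - (1 + x i * x i) powr real p))"
      using pert_gain_pos[OF pos \<epsilon>, where \<alpha> = "real p"] False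
      by (intro sum_nonneg mult_nonneg_nonneg) (auto intro: less_imp_le)
    moreover have "0 \<le> quad_form {..<n} (\<lambda>i j. (1 + x i * x j) powr real p) v"
      using pos_semidef_powr_nat[of n x p] pos by (simp add: pos_semidef_def)
    ultimately show "0 \<le> quad_form {..<n} (\<lambda>i j. pert_entry m x \<epsilon> i j powr real p) v"
      using quad_form_pert_powr[of n x \<epsilon> m "real p" v] pos \<epsilon> by simp
  qed
qed

text \<open>A null vector must vanish on the perturbed indices, where the diagonal gain is positive. What
  remains is a null vector of the unperturbed power on \<open>m\<close> points, and the exponent \<open>p \<ge> m - 1\<close> is
  not one of the exceptions to independence.\<close>

lemma pos_def_pert_nat:
  assumes pos: "\<And>i. i < n \<Longrightarrow> x i > 0" and inj: "inj_on x {..<n}" and \<epsilon>: "0 < \<epsilon>"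
    and m: "m \<le> n" "m \<le> Suc p" and p: "0 < p"
  shows "pos_def {..<n} (\<lambda>i j. pert_entry m x \<epsilon> i j powr real p)"
  unfolding pos_def_def
proof (intro allI impI)
  fix v :: "nat \<Rightarrow> real" assume v: "\<exists>i\<in>{..<n}. v i \<noteq> 0"
  define Q where "Q = quad_form {..<n} (\<lambda>i j. (1 + x i * x j) powr real p) v"
  define D where "D i = (1 + x i * x i + \<epsilon>) powr real p - (1 + x i * x i) powr real p" for i
  have D: "0 < D i" if "i < n" for i
    using pert_gain_pos[OF pos[OF that] \<epsilon>, of "real p"] p by (simp add: D_def)
  have psd: "pos_semidef {..<n} (\<lambda>i j. (1 + x i * x j) powr real p)"
    by (rule pos_semidef_powr_nat[OF pos])
  have eq: "quad_form {..<n} (\<lambda>i j. pert_entry m x \<epsilon> i j powr real p) v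
      = Q + (\<Sum>i\<in>{m..<n}. (v i)\<^sup>2 * D i)"
    using quad_form_pert_powr[of n x \<epsilon> m "real p" v] pos \<epsilon> by (simp add: Q_def D_def)
  have Q: "0 \<le> Q" using psd by (simp add: Q_def pos_semidef_def)
  have S: "0 \<le> (\<Sum>i\<in>{m..<n}. (v i)\<^sup>2 * D i)"
    using D by (intro sum_nonneg mult_nonneg_nonneg) (auto intro: less_imp_le)
  show "0 < quad_form {..<n} (\<lambda>i j. pert_entry m x \<epsilon> i j powr real p) v"
  proof (rule ccontr)
    assume "\<not> ?thesis"
    then have Q0: "Q = 0" and S0: "(\<Sum>i\<in>{m..<n}. (v i)\<^sup>2 * D i) = 0"
      using Q S eq by linarith+
    from S0 have "\<forall>i\<in>{m..<n}. (v i)\<^sup>2 * D i = 0"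
      using D by (subst (asm) sum_nonneg_eq_0_iff) (auto intro!: mult_nonneg_nonneg intro: less_imp_le)
    then have last: "v i = 0" if "m \<le> i" "i < n" for i
      using that D[of i] by auto
    have ker: "(\<Sum>j<m. v j * (1 + x i * x j) powr real p) = 0" if "i < m" for i
    proof -
      have "(\<Sum>j<m. v j * (1 + x i * x j) powr real p) = (\<Sum>j<n. v j * (1 + x i * x j) powr real p)"
        using m last by (intro sum.mono_neutral_left) auto
      also have "\<dots> = 0"
        by (rule quad_form_null_imp_kernel[where F = "\<lambda>i j. (1 + x i * x j) powr real p"])
          (use psd Q0 that m in \<open>auto simp: mult.commute Q_def\<close>)
      finally show ?thesis .
    qed
    have injm: "inj_on x {..<m}" using inj m by (auto simp: inj_on_def)
    have "v i = 0" if "i < m" for i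
    proof (rule affine_powers_independent[where I = "{..<m}" and Z = "x ` {..<m}" and r = "real p" and x = x])
      show "(\<Sum>i<m. v i * (1 + z * x i) powr real p) = 0" if "z \<in> x ` {..<m}" for z
        using that ker by auto
    qed (use injm m that pos in \<open>auto simp: card_image intro!: less_imp_le\<close>)
    with last v show False by (metis lessThan_iff not_le)
  qed
qed

text \<open>The first \<open>l + 3\<close> points lie in the unperturbed block.\<close>

lemma not_pos_semidef_pert_fractional:
  assumes pos: "\<And>i. i < n \<Longrightarrow> x i > 0" and inj: "inj_on x {..<n}"
    and l: "l + 3 \<le> m" "m \<le> n" and \<alpha>: "real l < \<alpha>" "\<alpha> < real l + 1"
  shows "\<not> pos_semidef {..<n} (\<lambda>i j. pert_entry m x \<epsilon> i j powr \<alpha>)"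
proof
  assume "pos_semidef {..<n} (\<lambda>i j. pert_entry m x \<epsilon> i j powr \<alpha>)"
  then have "pos_semidef {..<l + 3} (\<lambda>i j. pert_entry m x \<epsilon> i j powr \<alpha>)"
    by (rule pos_semidef_subset[rotated 2]) (use l in auto)
  then have "pos_semidef {..<l + 3} (\<lambda>i j. (1 + x i * x j) powr \<alpha>)"
    using l by (subst (asm) pos_semidef_cong) (auto simp: pert_entry_def)
  moreover have "inj_on x {..<l + 3}" using inj l by (auto simp: inj_on_def)
  ultimately show False
    using not_pos_semidef_fractional_power[of "{..<l + 3}" x l \<alpha>] pos l \<alpha> by auto
qed

lemma eventually_not_pos_semidef_pert:
  assumes pos: "\<And>i. i < n \<Longrightarrow> x i > 0" and inj: "inj_on x {..<n}"
    and l: "l + 3 \<le> n" and \<alpha>: "real l < \<alpha>" "\<alpha> < real l + 1"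
  shows "eventually (\<lambda>\<epsilon>. \<not> pos_semidef {..<n} (\<lambda>i j. pert_entry m x \<epsilon> i j powr \<alpha>)) (at_right 0)"
proof -
  have "\<not> pos_semidef {..<n} (\<lambda>i j. pert_entry m x 0 i j powr \<alpha>)"
    \<comment> \<open>For \<open>\<epsilon> = 0\<close> no index is perturbed, so the split point may be moved to \<open>n\<close>.\<close>
    using not_pos_semidef_pert_fractional[OF pos inj l _ \<alpha>, of 0]
    by (simp add: pert_entry_def)
  then obtain v where v: "quad_form {..<n} (\<lambda>i j. pert_entry m x 0 i j powr \<alpha>) v < 0"
    by (auto simp: pos_semidef_def not_le)
  have "((\<lambda>\<epsilon>. pert_entry m x \<epsilon> i j powr \<alpha>) \<longlongrightarrow> pert_entry m x 0 i j powr \<alpha>) (at_right 0)"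
    if "i < n" "j < n" for i j
  proof -
    have "0 < 1 + x i * x j" using that pos by (simp add: add_pos_pos)
    then show ?thesis unfolding pert_entry_def by (auto intro!: tendsto_eq_intros)
  qed
  then have "((\<lambda>\<epsilon>. quad_form {..<n} (\<lambda>i j. pert_entry m x \<epsilon> i j powr \<alpha>) v)
      \<longlongrightarrow> quad_form {..<n} (\<lambda>i j. pert_entry m x 0 i j powr \<alpha>) v) (at_right 0)"
    unfolding quad_form_def by (intro tendsto_sum tendsto_mult tendsto_const) auto
  from order_tendstoD(2)[OF this v] show ?thesis
    by eventually_elim (auto simp: pos_semidef_def not_le)
qed

lemma pos_semidef_pert_near_nat:
  assumes pos: "\<And>i. i < n \<Longrightarrow> x i > 0" and inj: "inj_on x {..<n}" and \<epsilon>: "0 < \<epsilon>"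
    and m: "m \<le> n" "m \<le> Suc p" and p: "0 < p"
  shows "eventually (\<lambda>\<delta>. \<forall>\<alpha>\<in>{real p - \<delta>..real p + \<delta>}.
    0 \<le> \<alpha> \<and> pos_semidef {..<n} (\<lambda>i j. pert_entry m x \<epsilon> i j powr \<alpha>)) (at_right 0)"
proof -
  have "eventually (\<lambda>\<alpha>. pos_def {..<n} (\<lambda>i j. pert_entry m x \<epsilon> i j powr \<alpha>)) (nhds (real p))"
  proof (rule eventually_pos_def[OF _ _ _ _ pos_def_pert_nat[OF assms]])
    show "((\<lambda>\<alpha>. pert_entry m x \<epsilon> i j powr \<alpha>) \<longlongrightarrow> pert_entry m x \<epsilon> i j powr real p) (nhds (real p))"
      if "i \<in> {..<n}" "j \<in> {..<n}" for i j
    proof -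
      have "0 < pert_entry m x \<epsilon> i j"
        using that pos[of i] pos[of j] \<epsilon> by (auto simp: pert_entry_def add_pos_nonneg)
      then show ?thesis by (intro tendsto_intros filterlim_ident) auto
    qed
  qed (auto simp: pert_entry_commute)
  then obtain d where d: "0 < d"
    "\<And>\<alpha>. \<bar>\<alpha> - real p\<bar> < d \<Longrightarrow> pos_def {..<n} (\<lambda>i j. pert_entry m x \<epsilon> i j powr \<alpha>)"
    by (auto simp: eventually_nhds_metric dist_real_def)
  show ?thesis
    unfolding eventually_at_right_field
  proof (intro exI[of _ "min 1 d"] conjI allI impI ballI)
    fix \<delta> \<alpha> assume "0 < \<delta>" "\<delta> < min 1 d" "\<alpha> \<in> {real p - \<delta>..real p + \<delta>}"
    then show "0 \<le> \<alpha>" "pos_semidef {..<n} (\<lambda>i j. pert_entry m x \<epsilon> i j powr \<alpha>)"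
      using p by (auto intro!: pos_def_imp_pos_semidef d(2))
  qed (use d in auto)
qed

theorem theorem1:
  fixes n k :: nat and x :: "nat \<Rightarrow> real"
  assumes "n \<ge> 4" and "2 \<le> k" and "k \<le> n - 2"
    and "\<And>i. i < n \<Longrightarrow> x i > 0"
    and "inj_on x {..<n}"
  shows "\<exists>\<epsilon>\<^sub>0 > 0. \<forall>\<epsilon>. 0 < \<epsilon> \<and> \<epsilon> < \<epsilon>\<^sub>0 \<longrightarrow>
      (\<exists>\<delta> > 0. \<forall>l \<in> {n - k - 1 .. n - 3}.
         {real l - \<delta> .. real l + \<delta>} \<subseteq> psd_powers (A_pert n k x \<epsilon>)) \<and>
      (\<forall>l \<in> {n - k - 1 .. n - 3}.
         \<exists>\<alpha>. real l < \<alpha> \<and> \<alpha> < real l + 1 \<and> \<alpha> \<notin> psd_powers (A_pert n k x \<epsilon>)) \<and>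
      psd_powers (A_pert n k x \<epsilon>) \<inter> {0 .. real (n - k - 2)} = real ` {0 .. n - k - 2}"
proof -
  define m where "m = n - k"
  have m: "2 \<le> m" "m \<le> n" using assms(1-3) by (auto simp: m_def)
  note pos = assms(4) and inj = assms(5)
  have "eventually (\<lambda>\<epsilon>. \<forall>l\<in>{m - 1 .. n - 3}.
      \<not> pos_semidef {..<n} (\<lambda>i j. pert_entry m x \<epsilon> i j powr (real l + 1 / 2))) (at_right 0)"
  proof (intro eventually_ball_finite ballI)
    fix l assume "l \<in> {m - 1 .. n - 3}"
    then have "l + 3 \<le> n" using assms(1) by auto
    then show "eventually (\<lambda>\<epsilon>. \<not> pos_semidef {..<n}
        (\<lambda>i j. pert_entry m x \<epsilon> i j powr (real l + 1 / 2))) (at_right 0)"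
      by (intro eventually_not_pos_semidef_pert[OF pos inj, of l]) auto
  qed simp
  then obtain \<epsilon>\<^sub>0 where \<epsilon>0: "0 < \<epsilon>\<^sub>0" "\<And>\<epsilon> l. 0 < \<epsilon> \<Longrightarrow> \<epsilon> < \<epsilon>\<^sub>0 \<Longrightarrow> l \<in> {m - 1 .. n - 3} \<Longrightarrow>
      \<not> pos_semidef {..<n} (\<lambda>i j. pert_entry m x \<epsilon> i j powr (real l + 1 / 2))"
    by (auto simp: eventually_at_right_field)
  show ?thesis
  proof (rule exI[of _ \<epsilon>\<^sub>0], intro conjI allI impI)
    fix \<epsilon> assume "0 < \<epsilon> \<and> \<epsilon> < \<epsilon>\<^sub>0"
    then have \<epsilon>: "0 < \<epsilon>" "\<epsilon> < \<epsilon>\<^sub>0" by auto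
    have mem: "\<alpha> \<in> psd_powers (A_pert n k x \<epsilon>) \<longleftrightarrow>
        0 \<le> \<alpha> \<and> pos_semidef {..<n} (\<lambda>i j. pert_entry m x \<epsilon> i j powr \<alpha>)" for \<alpha>
      unfolding m_def by (rule mem_psd_powers_iff) (use pos \<epsilon> in auto)
    have "eventually (\<lambda>\<delta>. \<forall>l \<in> {m - 1 .. n - 3}. \<forall>\<alpha>\<in>{real l - \<delta>..real l + \<delta>}.
        0 \<le> \<alpha> \<and> pos_semidef {..<n} (\<lambda>i j. pert_entry m x \<epsilon> i j powr \<alpha>)) (at_right 0)"
      using m by (intro eventually_ball_finite ballI pos_semidef_pert_near_nat[OF pos inj \<epsilon>(1)]) auto
    then obtain b where b: "0 < b" "\<And>\<delta>. 0 < \<delta> \<Longrightarrow> \<delta> < b \<Longrightarrow> \<forall>l \<in> {m - 1 .. n - 3}. \<forall>\<alpha>\<in>{real l - \<delta>..real l + \<delta>}.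
        0 \<le> \<alpha> \<and> pos_semidef {..<n} (\<lambda>i j. pert_entry m x \<epsilon> i j powr \<alpha>)"
      by (auto simp: eventually_at_right_field)
    show "\<exists>\<delta> > 0. \<forall>l \<in> {n - k - 1 .. n - 3}.
         {real l - \<delta> .. real l + \<delta>} \<subseteq> psd_powers (A_pert n k x \<epsilon>)"
      using b(1) b(2)[of "b / 2"] unfolding m_def[symmetric]
      by (intro exI[of _ "b / 2"]) (auto simp: mem)
    show "\<forall>l \<in> {n - k - 1 .. n - 3}.
         \<exists>\<alpha>. real l < \<alpha> \<and> \<alpha> < real l + 1 \<and> \<alpha> \<notin> psd_powers (A_pert n k x \<epsilon>)"
    proof
      fix l assume "l \<in> {n - k - 1 .. n - 3}"
      then show "\<exists>\<alpha>. real l < \<alpha> \<and> \<alpha> < real l + 1 \<and> \<alpha> \<notin> psd_powers (A_pert n k x \<epsilon>)"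
        using \<epsilon>0(2)[OF \<epsilon>, of l]
        by (intro exI[of _ "real l + 1 / 2"]) (auto simp: mem m_def)
    qed
    show "psd_powers (A_pert n k x \<epsilon>) \<inter> {0 .. real (n - k - 2)} = real ` {0 .. n - k - 2}"
      unfolding m_def[symmetric]
    proof (intro equalityI subsetI)
      fix \<alpha> assume \<alpha>: "\<alpha> \<in> psd_powers (A_pert n k x \<epsilon>) \<inter> {0 .. real (m - 2)}"
      define l where "l = nat \<lfloor>\<alpha>\<rfloor>"
      have l: "real l \<le> \<alpha>" "\<alpha> < real l + 1"
        using \<alpha> by (auto simp: l_def)
      have "\<alpha> = real l"
      proof (rule ccontr)
        assume "\<alpha> \<noteq> real l"
        then have l': "real l < \<alpha>" using l by simp
        then have "real l < real (m - 2)" using \<alpha> by simp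
        then have "l + 3 \<le> m" by simp
        from not_pos_semidef_pert_fractional[OF pos inj this m(2) l' l(2)] \<alpha> mem
        show False by auto
      qed
      moreover from this \<alpha> have "l \<le> m - 2" by simp
      ultimately show "\<alpha> \<in> real ` {0 .. m - 2}" by auto
    next
      fix \<alpha> assume "\<alpha> \<in> real ` {0 .. m - 2}"
      then show "\<alpha> \<in> psd_powers (A_pert n k x \<epsilon>) \<inter> {0 .. real (m - 2)}"
        using pos_semidef_pert_nat[OF pos \<epsilon>(1), where m = m] by (auto simp: mem)
    qed
  qed (rule \<epsilon>0(1))
qed

end
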